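(* Let $A$ be a von Neumann algebra, let $M$ be a Hilbert $A$-module, and let $\{e_i\}_{i\in I}$ be an orthogonal system of norm one vectors in $M$. Then for any vector $x\in M$ the net $$a_F=2\sum_{i\in F}\langle x,e_i\rangle\langle e_i,x\rangle-\sum_{i\in F}\langle x,e_i\rangle\langle e_i,e_i\rangle\langle e_i,x\rangle,$$ indexed by the finite subsets $F$ of $I$ (directed by inclusion), converges with respect to the strong (operator) topology.
   Context: A Hilbert $A$-module is a right $A$-module $M$ (compatibly a complex vector space) with an $A$-valued inner product $\langle\cdot,\cdot\rangle$ that is linear in the second variable and satisfies $\langle x,ya\rangle=\langle x,y\rangle a$, $\langle x,y\rangle^*=\langle y,x\rangle$, $\langle x,x\rangle\ge 0$, and $\langle x,x\rangle=0$ only if $x=0$, and which is complete in the norm $\|x\|=\|\langle x,x\rangle\|^{1/2}$. A collection $\{e_i\}_{i\in I}$ of vectors of $M$, indexed by some set $I$, is called an orthogonal system if $\langle e_i,e_j\rangle=0$ whenever $i\neq j$. The von Neumann algebra $A$ is regarded as acting on a Hilbert space $G$, $A\subset B(G)$, and the strong topology is the strong operator topology of $B(G)$. *)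

theory Defs
  imports "HOL-Analysis.Analysis"
begin

text \<open>Complex vector spaces, with the real structure obtained by restriction of scalars.\<close>

class complex_vector = real_vector +
  fixes scaleC :: "complex \<Rightarrow> 'a \<Rightarrow> 'a"  (infixr "*\<^sub>C" 75)
  assumes scaleC_add_right: "c *\<^sub>C (x + y) = c *\<^sub>C x + c *\<^sub>C y"
    and scaleC_add_left: "(c + d) *\<^sub>C x = c *\<^sub>C x + d *\<^sub>C x"
    and scaleC_scaleC: "c *\<^sub>C d *\<^sub>C x = (c * d) *\<^sub>C x"
    and scaleC_of_real: "complex_of_real r *\<^sub>C x = r *\<^sub>R x"

text \<open>The inner product is linear in the second variable. Axiom \<open>cinner_self\<close> states
  positivity, definiteness and compatibility with the (complete) norm in one equation.\<close>

class chilbert_space = complex_vector + banach +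
  fixes cinner :: "'a \<Rightarrow> 'a \<Rightarrow> complex"
  assumes cinner_commute: "cinner x y = cnj (cinner y x)"
    and cinner_add_right: "cinner x (y + z) = cinner x y + cinner x z"
    and cinner_scaleC_right: "cinner x (c *\<^sub>C y) = c * cinner x y"
    and cinner_self: "cinner x x = complex_of_real ((norm x)\<^sup>2)"

lemma norm_scaleC: "norm (c *\<^sub>C x) = cmod c * norm x" for x :: "'a::chilbert_space"
proof -
  have "cinner (c *\<^sub>C x) (c *\<^sub>C x) = c * cinner (c *\<^sub>C x) x"
    by (rule cinner_scaleC_right)
  also have "cinner (c *\<^sub>C x) x = cnj (cinner x (c *\<^sub>C x))"
    by (rule cinner_commute)
  also have "\<dots> = cnj c * complex_of_real ((norm x)\<^sup>2)"
    by (simp add: cinner_scaleC_right cinner_self)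
  finally have "complex_of_real ((norm (c *\<^sub>C x))\<^sup>2) = complex_of_real ((cmod c * norm x)\<^sup>2)"
    unfolding cinner_self
    by (simp add: mult.assoc[symmetric] complex_norm_square[symmetric] power_mult_distrib)
  then have "(norm (c *\<^sub>C x))\<^sup>2 = (cmod c * norm x)\<^sup>2"
    by (simp only: of_real_eq_iff)
  then show ?thesis
    by simp
qed

lemma bounded_linear_scaleC: "bounded_linear ((*\<^sub>C) c :: 'a \<Rightarrow> 'a::chilbert_space)"
proof (rule bounded_linear_intro[where K = "cmod c"])
  show "c *\<^sub>C (r *\<^sub>R x) = r *\<^sub>R (c *\<^sub>C x)" for r and x :: 'a
    by (simp add: scaleC_of_real[symmetric] scaleC_scaleC mult.commute)
qed (simp_all add: scaleC_add_right norm_scaleC mult.commute)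

instantiation blinfun :: (real_normed_vector, chilbert_space) complex_vector
begin

lift_definition scaleC_blinfun :: "complex \<Rightarrow> ('a \<Rightarrow>\<^sub>L 'b) \<Rightarrow> ('a \<Rightarrow>\<^sub>L 'b)"
  is "\<lambda>c T g. c *\<^sub>C T g"
  by (rule bounded_linear_compose[OF bounded_linear_scaleC])

instance
  by (standard; transfer)
    (simp_all add: scaleC_add_right scaleC_add_left scaleC_scaleC scaleC_of_real)

end

definition is_adjoint :: "('g::chilbert_space \<Rightarrow>\<^sub>L 'g) \<Rightarrow> ('g \<Rightarrow>\<^sub>L 'g) \<Rightarrow> bool" where
  "is_adjoint T S \<longleftrightarrow> (\<forall>g h. cinner (T g) h = cinner g (S h))"

definition positive_operator :: "('g::chilbert_space \<Rightarrow>\<^sub>L 'g) \<Rightarrow> bool" where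
  "positive_operator T \<longleftrightarrow> (\<forall>g. cinner g (T g) \<in> \<real>\<^sub>\<ge>\<^sub>0)"

text \<open>The type \<open>'g \<Rightarrow>\<^sub>L 'g\<close> consists of all bounded real-linear operators, so
  membership in \<open>B(G)\<close>, i.e. complex linearity, is imposed explicitly. As \<open>B(G)\<close> is closed
  in \<open>'g \<Rightarrow>\<^sub>L 'g\<close> for \<^const>\<open>strong_operator_topology\<close>, closedness may be
  stated in the larger space.\<close>

definition von_neumann_algebra :: "('g::chilbert_space \<Rightarrow>\<^sub>L 'g) set \<Rightarrow> bool" where
  "von_neumann_algebra A \<longleftrightarrow>
     (\<forall>T\<in>A. \<forall>c g. T (c *\<^sub>C g) = c *\<^sub>C T g) \<and>
     id_blinfun \<in> A \<and>
     (\<forall>S\<in>A. \<forall>T\<in>A. S + T \<in> A) \<and>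
     (\<forall>T\<in>A. \<forall>c. c *\<^sub>C T \<in> A) \<and>
     (\<forall>S\<in>A. \<forall>T\<in>A. S o\<^sub>L T \<in> A) \<and>
     (\<forall>T\<in>A. \<exists>S\<in>A. is_adjoint T S) \<and>
     closedin strong_operator_topology A"

text \<open>The action \<open>act x a\<close> (written $x a$ in mathematics) is only constrained for
  \<open>a \<in> A\<close>. Completeness of the module is part of the class \<^class>\<open>banach\<close>, whose
  norm is tied to the inner product by \<open>norm_eq\<close>.\<close>

locale hilbert_module =
  fixes A :: "('g::chilbert_space \<Rightarrow>\<^sub>L 'g) set"
    and act :: "'m::{complex_vector, banach} \<Rightarrow> ('g \<Rightarrow>\<^sub>L 'g) \<Rightarrow> 'm"
    and ip :: "'m \<Rightarrow> 'm \<Rightarrow> ('g \<Rightarrow>\<^sub>L 'g)"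
  assumes act_add_left: "a \<in> A \<Longrightarrow> act (x + y) a = act x a + act y a"
    and act_add_right: "a \<in> A \<Longrightarrow> b \<in> A \<Longrightarrow> act x (a + b) = act x a + act x b"
    and act_mult: "a \<in> A \<Longrightarrow> b \<in> A \<Longrightarrow> act x (a o\<^sub>L b) = act (act x a) b"
    and act_one: "act x id_blinfun = x"
    and act_scaleC_left: "a \<in> A \<Longrightarrow> act (c *\<^sub>C x) a = c *\<^sub>C act x a"
    and act_scaleC_right: "a \<in> A \<Longrightarrow> act x (c *\<^sub>C a) = c *\<^sub>C act x a"
    and ip_in: "ip x y \<in> A"
    and ip_add_right: "ip x (y + z) = ip x y + ip x z"
    and ip_scaleC_right: "ip x (c *\<^sub>C y) = c *\<^sub>C ip x y"
    and ip_act_right: "a \<in> A \<Longrightarrow> ip x (act y a) = ip x y o\<^sub>L a"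
    and ip_adjoint: "is_adjoint (ip x y) (ip y x)"
    and ip_positive: "positive_operator (ip x x)"
    and ip_definite: "ip x x = 0 \<Longrightarrow> x = 0"
    and norm_eq: "norm x = sqrt (norm (ip x x))"

definition orthogonal_system :: "('m \<Rightarrow> 'm \<Rightarrow> 'b::zero) \<Rightarrow> 'i set \<Rightarrow> ('i \<Rightarrow> 'm) \<Rightarrow> bool" where
  "orthogonal_system ip I e \<longleftrightarrow> (\<forall>i\<in>I. \<forall>j\<in>I. i \<noteq> j \<longrightarrow> ip (e i) (e j) = 0)"

end

theory Submission
  imports Defs
begin

text \<open>
  Write \<open>b\<^sub>i = \<langle>e\<^sub>i, x\<rangle>\<close> and \<open>p\<^sub>i = \<langle>e\<^sub>i, e\<^sub>i\<rangle>\<close>. By \<open>\<langle>x, e\<^sub>i\<rangle> = b\<^sub>i\<^sup>*\<close> the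
  net is the net of partial sums of the operators \<open>t\<^sub>i = b\<^sub>i\<^sup>*(2 - p\<^sub>i)b\<^sub>i\<close>. Since \<open>0 \<le> p\<^sub>i \<le> 1\<close>, each \<open>t\<^sub>i\<close>
  is positive, so the net is increasing. It is also bounded: although \<open>p\<^sub>i\<close> need not be a
  projection, expanding the inner square of the remainder \<open>y\<^sub>F = x - (\<Sum>i\<in>F. e\<^sub>i b\<^sub>i)\<close> and using
  orthogonality gives the Bessel identity \<open>\<langle>y\<^sub>F, y\<^sub>F\<rangle> = \<langle>x, x\<rangle> - a\<^sub>F\<close>, hence \<open>a\<^sub>F \<le> \<langle>x, x\<rangle>\<close>
  (\<open>module_bessel\<close>).

  A bounded increasing net of self-adjoint operators converges strongly. For sums of
  positive operators this is \<open>positive_operator_series_strongly_convergent\<close>, and rests on the estimate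
  \<open>\<parallel>T g\<parallel>\<^sup>2 \<le> C \<langle>g, T g\<rangle>\<close> for \<open>0 \<le> T \<le> C\<close>: it turns summability of the numbers
  \<open>\<langle>g, t\<^sub>i g\<rangle>\<close> into the Cauchy property of \<open>\<Sum>i. t\<^sub>i g\<close>. Finally the limit belongs to \<open>A\<close>, because \<open>A\<close> is
  strongly closed and contains every \<open>a\<^sub>F\<close>.
\<close>

section \<open>The real inner product of a complex Hilbert space\<close>

text \<open>Positivity of the operators and all norm estimates involve only the real parts of inner
  products. These form a bounded real bilinear map, whose rules for sums and differences
  then serve both arguments; the complex inner product is conjugate-linear in the first one.\<close>

definition re_inner :: "'g::chilbert_space \<Rightarrow> 'g \<Rightarrow> real" where
  "re_inner g h = Re (cinner g h)"

lemma re_inner_commute: "re_inner g h = re_inner h g"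
  unfolding re_inner_def by (subst cinner_commute) simp

lemma re_inner_self: "re_inner g g = (norm g)\<^sup>2"
  by (simp add: re_inner_def cinner_self)

lemma re_inner_add_right: "re_inner g (h + k) = re_inner g h + re_inner g k"
  by (simp add: re_inner_def cinner_add_right)

lemma re_inner_add_left: "re_inner (g + h) k = re_inner g k + re_inner h k"
  by (metis re_inner_add_right re_inner_commute)

lemma re_inner_scaleR_right: "re_inner g (r *\<^sub>R h) = r * re_inner g h"
  by (simp add: re_inner_def scaleC_of_real[symmetric] cinner_scaleC_right)

text \<open>Polarization turns the triangle inequality of the norm into the Cauchy-Schwarz inequality.\<close>

lemma re_inner_le_norm: "re_inner g h \<le> norm g * norm h"
proof -
  have "(norm (g + h))\<^sup>2 = (norm g)\<^sup>2 + 2 * re_inner g h + (norm h)\<^sup>2"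
    unfolding re_inner_self[symmetric] re_inner_add_left re_inner_add_right
    using re_inner_commute[of g h] by simp
  moreover have "(norm (g + h))\<^sup>2 \<le> (norm g + norm h)\<^sup>2"
    by (rule power_mono[OF norm_triangle_ineq]) simp
  ultimately show ?thesis
    by (simp add: power2_sum)
qed

lemma bounded_bilinear_re_inner: "bounded_bilinear re_inner"
proof
  show "re_inner (r *\<^sub>R g) h = r *\<^sub>R re_inner g h" for r and g h :: 'a
    by (metis re_inner_commute re_inner_scaleR_right real_scaleR_def)
  have "norm (re_inner g h) \<le> norm g * norm h * 1" for g h :: 'a
  proof -
    have "- re_inner g h = re_inner g ((-1) *\<^sub>R h)"
      by (simp only: re_inner_scaleR_right)
    also have "\<dots> \<le> norm g * norm h"
      using re_inner_le_norm[of g "(-1) *\<^sub>R h"] by simp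
    finally show ?thesis
      using re_inner_le_norm[of g h] by simp
  qed
  then show "\<exists>K. \<forall>g h. norm (re_inner g h) \<le> norm (g :: 'a) * norm h * K"
    by blast
qed (simp_all add: re_inner_add_left re_inner_add_right re_inner_scaleR_right)

interpretation re_inner: bounded_bilinear re_inner
  by (rule bounded_bilinear_re_inner)

lemma re_inner_blinfun_le:
  fixes T :: "'g::chilbert_space \<Rightarrow>\<^sub>L 'g"
  shows "re_inner g (T g) \<le> norm T * (norm g)\<^sup>2"
proof -
  have "re_inner g (T g) \<le> norm g * norm (T g)"
    by (rule re_inner_le_norm)
  also have "\<dots> \<le> norm g * (norm T * norm g)"
    by (intro mult_left_mono norm_blinfun) simp
  finally show ?thesis
    by (simp add: power2_eq_square mult_ac)
qed

lemma re_inner_adjoint: "is_adjoint T S \<Longrightarrow> re_inner (T g) h = re_inner g (S h)"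
  by (simp add: is_adjoint_def re_inner_def)

lemma re_inner_positive: "positive_operator T \<Longrightarrow> 0 \<le> re_inner g (T g)"
  by (auto simp: positive_operator_def re_inner_def complex_nonneg_Reals_iff)

section \<open>Strong convergence of bounded sums of positive operators\<close>

text \<open>This is \<open>T\<^sup>2 \<le> C T\<close> for \<open>0 \<le> T \<le> C\<close>, evaluated at a vector. It follows from
  positivity of \<open>T\<close> at \<open>g - (1/C) T g\<close>: the quadratic term in \<open>T g\<close> is at most
  \<open>(1/C) \<parallel>T g\<parallel>\<^sup>2\<close>, half of what the mixed terms subtract.\<close>

lemma norm_positive_apply_le:
  fixes T :: "'g::chilbert_space \<Rightarrow>\<^sub>L 'g"
  assumes sym: "\<And>g h. re_inner (T g) h = re_inner g (T h)"
    and pos: "\<And>g. 0 \<le> re_inner g (T g)"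
    and le: "\<And>g. re_inner g (T g) \<le> C * (norm g)\<^sup>2"
    and "C > 0"
  shows "(norm (T g))\<^sup>2 \<le> C * re_inner g (T g)"
proof -
  let ?n = "(norm (T g))\<^sup>2"
  have "0 \<le> re_inner (g - (1/C) *\<^sub>R T g) (T (g - (1/C) *\<^sub>R T g))"
    by (rule pos)
  also have "\<dots> = re_inner g (T g) - (2/C) * ?n + (1/C)\<^sup>2 * re_inner (T g) (T (T g))"
    using sym[of g "T g"]
    by (simp add: blinfun.diff_right blinfun.scaleR_right re_inner.diff_left re_inner.diff_right
        re_inner.scaleR_left re_inner.scaleR_right re_inner_self power2_eq_square algebra_simps)
  also have "\<dots> \<le> re_inner g (T g) - (2/C) * ?n + (1/C)\<^sup>2 * (C * ?n)"
    using le[of "T g"] by (intro add_left_mono mult_left_mono) simp_all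
  also have "\<dots> = re_inner g (T g) - ?n / C"
    using \<open>C > 0\<close> by (simp add: power2_eq_square field_simps)
  finally show ?thesis
    using \<open>C > 0\<close> by (simp add: field_simps)
qed

lemma summable_on_Cauchy_tails:
  fixes f :: "'i \<Rightarrow> 'a::banach"
  assumes tails: "\<And>\<epsilon>. \<epsilon> > 0 \<Longrightarrow>
    \<exists>X. finite X \<and> X \<subseteq> I \<and> (\<forall>Y. finite Y \<and> Y \<subseteq> I \<and> X \<inter> Y = {} \<longrightarrow> norm (sum f Y) < \<epsilon>)"
  shows "f summable_on I"
proof -
  have "\<exists>P. eventually P (finite_subsets_at_top I) \<and>
      (\<forall>F G. P F \<and> P G \<longrightarrow> dist (sum f F) (sum f G) < \<epsilon>)" if "\<epsilon> > 0" for \<epsilon>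
  proof -
    obtain X where X: "finite X" "X \<subseteq> I"
      and small: "\<And>Y. finite Y \<Longrightarrow> Y \<subseteq> I \<Longrightarrow> X \<inter> Y = {} \<Longrightarrow> norm (sum f Y) < \<epsilon>/2"
      using tails[OF half_gt_zero[OF \<open>\<epsilon> > 0\<close>]] by (elim exE conjE) simp
    define P where "P F \<longleftrightarrow> finite F \<and> X \<subseteq> F \<and> F \<subseteq> I" for F
    have "eventually P (finite_subsets_at_top I)"
      unfolding eventually_finite_subsets_at_top P_def using X by (intro exI[of _ X]) simp
    moreover have near: "dist (sum f F) (sum f X) < \<epsilon>/2" if "P F" for F
    proof -
      have "sum f F - sum f X = sum f (F - X)"
        using that by (simp add: P_def sum_diff)
      then show ?thesis
        using small[of "F - X"] that by (auto simp: P_def dist_norm)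
    qed
    have "dist (sum f F) (sum f G) < \<epsilon>" if "P F" "P G" for F G
      using dist_triangle_half_l[OF near near] that by blast
    ultimately show ?thesis
      by blast
  qed
  then have "cauchy_filter (filtermap (sum f) (finite_subsets_at_top I))"
    by (simp add: cauchy_filter_metric_filtermap)
  then have "convergent_filter (filtermap (sum f) (finite_subsets_at_top I))"
    by (rule cauchy_filter_convergent)
  then show ?thesis
    by (auto simp: convergent_filter_iff summable_on_def has_sum_def filterlim_def)
qed

lemma limitin_strong_operator_topologyI:
  assumes "\<And>g. ((\<lambda>k. blinfun_apply (T k) g) \<longlongrightarrow> blinfun_apply a g) F"
  shows "limitin strong_operator_topology T a F"
proof -
  have "limitin (product_topology (\<lambda>g. euclidean) UNIV) (\<lambda>k. blinfun_apply (T k)) (blinfun_apply a) F"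
    using assms by (simp add: limitin_componentwise)
  then have "((\<lambda>k. blinfun_apply (T k)) \<longlongrightarrow> blinfun_apply a) F"
    by (simp add: euclidean_product_topology)
  then show ?thesis
    by (auto simp: limitin_def strong_operator_topology_topspace strong_operator_topology_def
        openin_pullback_topology topspace_pullback_topology tendsto_def)
qed

text \<open>The pointwise limit is automatically a bounded operator, because each partial sum \<open>T\<close>
  satisfies \<open>\<parallel>T\<parallel> \<le> C\<close>.\<close>

lemma positive_operator_series_strongly_convergent:
  fixes t :: "'i \<Rightarrow> 'g::chilbert_space \<Rightarrow>\<^sub>L 'g"
  assumes sym: "\<And>i g h. i \<in> I \<Longrightarrow> re_inner (t i g) h = re_inner g (t i h)"
    and pos: "\<And>i g. i \<in> I \<Longrightarrow> 0 \<le> re_inner g (t i g)"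
    and bound: "\<And>F g. finite F \<Longrightarrow> F \<subseteq> I \<Longrightarrow> re_inner g ((\<Sum>i\<in>F. t i) g) \<le> C * (norm g)\<^sup>2"
    and "C > 0"
  shows "\<exists>a. limitin strong_operator_topology (\<lambda>F. \<Sum>i\<in>F. t i) a (finite_subsets_at_top I)"
proof -
  have sum_apply: "re_inner g ((\<Sum>i\<in>F. t i) g) = (\<Sum>i\<in>F. re_inner g (t i g))" for F g
    by (simp add: blinfun.sum_left re_inner.sum_right)
  have norm_sq: "(norm ((\<Sum>i\<in>F. t i) g))\<^sup>2 \<le> C * re_inner g ((\<Sum>i\<in>F. t i) g)"
    if "finite F" "F \<subseteq> I" for F g
  proof (rule norm_positive_apply_le)
    show "re_inner ((\<Sum>i\<in>F. t i) g) h = re_inner g ((\<Sum>i\<in>F. t i) h)" for g h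
      using sym that
      by (auto simp: blinfun.sum_left re_inner.sum_left re_inner.sum_right intro!: sum.cong)
    show "0 \<le> re_inner g ((\<Sum>i\<in>F. t i) g)" for g
      unfolding sum_apply using pos that by (intro sum_nonneg) auto
  qed (use bound that \<open>C > 0\<close> in auto)
  have norm_le: "norm ((\<Sum>i\<in>F. t i) g) \<le> norm g * C" if "finite F" "F \<subseteq> I" for F g
  proof -
    have "(norm ((\<Sum>i\<in>F. t i) g))\<^sup>2 \<le> C * (C * (norm g)\<^sup>2)"
      using norm_sq[OF that, of g] bound[OF that, of g] \<open>C > 0\<close>
      by (meson mult_left_mono order.trans less_imp_le)
    then have "(norm ((\<Sum>i\<in>F. t i) g))\<^sup>2 \<le> (norm g * C)\<^sup>2"
      by (simp add: power2_eq_square mult_ac)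
    then show ?thesis
      using \<open>C > 0\<close> by (simp add: power2_le_iff_abs_le)
  qed
  have summable: "(\<lambda>i. t i g) summable_on I" for g
  proof (rule summable_on_Cauchy_tails)
    fix \<epsilon> :: real assume "\<epsilon> > 0"
    define q where "q i = re_inner g (t i g)" for i
    have "q summable_on I"
    proof (rule nonneg_bdd_above_summable_on)
      show "bdd_above (sum q ` {F. F \<subseteq> I \<and> finite F})"
        using bound[of _ g] unfolding sum_apply q_def by (intro bdd_aboveI2) auto
    qed (simp add: q_def pos)
    then have "((\<lambda>F. sum q F) \<longlongrightarrow> infsum q I) (finite_subsets_at_top I)"
      by (rule infsum_tendsto)
    (* The radius is chosen so that \<open>C\<close> times a tail of \<open>q\<close>, a difference of two partial sums, stays below \<open>\<epsilon>\<^sup>2\<close>. *)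
    then have "eventually (\<lambda>F. dist (sum q F) (infsum q I) < \<epsilon>\<^sup>2 / (2 * C)) (finite_subsets_at_top I)"
      using \<open>\<epsilon> > 0\<close> \<open>C > 0\<close> by (intro tendstoD) auto
    then obtain X where X: "finite X" "X \<subseteq> I"
      and close: "\<And>F. finite F \<Longrightarrow> X \<subseteq> F \<Longrightarrow> F \<subseteq> I \<Longrightarrow> dist (sum q F) (infsum q I) < \<epsilon>\<^sup>2 / (2 * C)"
      unfolding eventually_finite_subsets_at_top by (elim exE conjE) simp
    have "norm (\<Sum>i\<in>Y. t i g) < \<epsilon>" if Y: "finite Y" "Y \<subseteq> I" "X \<inter> Y = {}" for Y
    proof -
      have "sum q (X \<union> Y) = sum q X + sum q Y"
        using X Y by (intro sum.union_disjoint) auto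
      moreover have "dist (sum q (X \<union> Y)) (infsum q I) < \<epsilon>\<^sup>2 / (2 * C)"
        "dist (sum q X) (infsum q I) < \<epsilon>\<^sup>2 / (2 * C)"
        using X Y by (auto intro!: close)
      ultimately have "sum q Y < \<epsilon>\<^sup>2 / (2 * C) + \<epsilon>\<^sup>2 / (2 * C)"
        by (simp add: dist_real_def)
      then have "C * sum q Y < \<epsilon>\<^sup>2"
        using \<open>C > 0\<close> by (simp add: field_simps)
      then have "(norm (\<Sum>i\<in>Y. t i g))\<^sup>2 < \<epsilon>\<^sup>2"
        using norm_sq[OF Y(1,2), of g] by (simp add: q_def blinfun.sum_left re_inner.sum_right)
      then show ?thesis
        using \<open>\<epsilon> > 0\<close> by (simp add: power2_less_imp_less)
    qed
    with X show "\<exists>X. finite X \<and> X \<subseteq> I \<and>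
        (\<forall>Y. finite Y \<and> Y \<subseteq> I \<and> X \<inter> Y = {} \<longrightarrow> norm (\<Sum>i\<in>Y. t i g) < \<epsilon>)"
      by (intro exI[of _ X]) simp
  qed
  define L where "L g = infsum (\<lambda>i. t i g) I" for g
  have has_sum: "((\<lambda>i. t i g) has_sum L g) I" for g
    unfolding L_def by (rule has_sum_infsum[OF summable])
  then have lim: "((\<lambda>F. (\<Sum>i\<in>F. t i) g) \<longlongrightarrow> L g) (finite_subsets_at_top I)" for g
    unfolding has_sum_def blinfun.sum_left .
  have "bounded_linear L"
  proof (rule bounded_linear_intro)
    show "L (g + h) = L g + L h" for g h
      using has_sum_add[OF has_sum has_sum, of g h] has_sum[of "g + h"]
      unfolding blinfun.add_right by (rule has_sum_unique[symmetric])
    show "L (r *\<^sub>R g) = r *\<^sub>R L g" for r g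
      using has_sum_scaleR[OF has_sum, of r g] has_sum[of "r *\<^sub>R g"]
      unfolding blinfun.scaleR_right by (rule has_sum_unique[symmetric])
    show "norm (L g) \<le> norm g * C" for g
      by (rule Lim_norm_ubound[OF _ lim])
        (auto intro!: eventually_finite_subsets_at_top_weakI norm_le)
  qed
  then have "limitin strong_operator_topology (\<lambda>F. \<Sum>i\<in>F. t i) (Blinfun L) (finite_subsets_at_top I)"
    using lim by (intro limitin_strong_operator_topologyI) (simp add: bounded_linear_Blinfun_apply)
  then show ?thesis
    by blast
qed

section \<open>The Bessel inequality in a Hilbert module\<close>

context hilbert_module
begin

lemma additive_ip_right: "Modules.additive (ip x)"
  by (simp add: Modules.additive_def ip_add_right)

text \<open>Only the right argument of \<open>ip\<close> is expanded algebraically. The left argument is reached by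
  moving \<open>ip\<close> across the inner product of \<open>G\<close>, which makes it a right argument.\<close>

lemma re_inner_ip_swap: "re_inner g (ip x y h) = re_inner (ip y x g) h"
  by (simp add: re_inner_adjoint[OF ip_adjoint])

text \<open>With \<open>b\<^sub>i = \<langle>e\<^sub>i, x\<rangle>\<close> and \<open>y = x - (\<Sum>i\<in>F. e\<^sub>i b\<^sub>i)\<close>, orthogonality gives
  \<open>\<langle>e\<^sub>i, y\<rangle> = b\<^sub>i - \<langle>e\<^sub>i, e\<^sub>i\<rangle> b\<^sub>i\<close>, so \<open>y\<close> need not be orthogonal to the
  \<open>e\<^sub>i\<close>; this is where the terms with \<open>\<langle>e\<^sub>i, e\<^sub>i\<rangle>\<close> come from. The right-hand side minus the
  left-hand side is the quadratic form of the positive operator \<open>\<langle>y, y\<rangle>\<close> at \<open>g\<close>.\<close>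

lemma module_bessel:
  assumes orth: "\<And>i j. i \<in> F \<Longrightarrow> j \<in> F \<Longrightarrow> i \<noteq> j \<Longrightarrow> ip (e i) (e j) = 0"
    and "finite F"
  shows "(\<Sum>i\<in>F. 2 * (norm (ip (e i) x g))\<^sup>2 -
      re_inner (ip (e i) x g) (ip (e i) (e i) (ip (e i) x g))) \<le> re_inner g (ip x x g)"
proof -
  define b where "b i = ip (e i) x" for i
  define y where "y = x - (\<Sum>i\<in>F. act (e i) (b i))"
  have ip_y: "ip z y = ip z x - (\<Sum>i\<in>F. ip z (e i) o\<^sub>L b i)" for z
    by (simp add: y_def b_def Modules.additive.diff[OF additive_ip_right] Modules.additive.sum[OF additive_ip_right]
        ip_act_right ip_in)
  have ip_e_y: "ip (e i) y = b i - (ip (e i) (e i) o\<^sub>L b i)" if "i \<in> F" for i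
  proof -
    have "(\<Sum>j\<in>F. ip (e i) (e j) o\<^sub>L b j) = (\<Sum>j\<in>F. if j = i then ip (e i) (e i) o\<^sub>L b i else 0)"
      using orth[OF that] by (intro sum.cong) (auto intro!: blinfun_eqI)
    also have "\<dots> = ip (e i) (e i) o\<^sub>L b i"
      using that \<open>finite F\<close> by simp
    finally show ?thesis
      by (simp add: ip_y b_def)
  qed
  have "re_inner g (ip y x g) = re_inner (ip x y g) g"
    by (rule re_inner_ip_swap)
  also have "\<dots> = re_inner g (ip x x g) - (\<Sum>i\<in>F. re_inner g (ip x (e i) (b i g)))"
    by (simp add: ip_y blinfun.diff_left blinfun.sum_left re_inner.diff_right re_inner.sum_right
        re_inner_commute[of _ g])
  also have "\<dots> = re_inner g (ip x x g) - (\<Sum>i\<in>F. (norm (b i g))\<^sup>2)"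
    by (simp add: re_inner_ip_swap re_inner_self b_def del: blinfun_apply_blinfun_compose)
  finally have y_x: "re_inner g (ip y x g) = \<dots>" .
  have y_e: "re_inner g (ip y (e i) (b i g)) =
      (norm (b i g))\<^sup>2 - re_inner (b i g) (ip (e i) (e i) (b i g))" if "i \<in> F" for i
    unfolding re_inner_ip_swap[of g y] ip_e_y[OF that]
    by (simp add: blinfun.diff_left re_inner.diff_left re_inner_self
        re_inner_commute[of "ip (e i) (e i) (b i g)"])
  have "0 \<le> re_inner g (ip y y g)"
    by (rule re_inner_positive[OF ip_positive])
  also have "\<dots> = re_inner g (ip y x g) - (\<Sum>i\<in>F. re_inner g (ip y (e i) (b i g)))"
    by (simp add: ip_y blinfun.diff_left blinfun.sum_left re_inner.diff_right re_inner.sum_right)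
  also have "\<dots> = re_inner g (ip x x g) - (\<Sum>i\<in>F. 2 * (norm (b i g))\<^sup>2 -
      re_inner (b i g) (ip (e i) (e i) (b i g)))"
    by (simp add: y_x y_e sum_subtractf sum_distrib_left[symmetric])
  finally show ?thesis
    by (simp add: b_def)
qed

end

section \<open>Convergence of the net\<close>

theorem proposition2p5:
  fixes A :: "('g::chilbert_space \<Rightarrow>\<^sub>L 'g) set"
    and act :: "'m::{complex_vector, banach} \<Rightarrow> ('g \<Rightarrow>\<^sub>L 'g) \<Rightarrow> 'm"
    and ip :: "'m \<Rightarrow> 'm \<Rightarrow> ('g \<Rightarrow>\<^sub>L 'g)"
    and I :: "'i set"
    and e :: "'i \<Rightarrow> 'm"
    and x :: 'm
  assumes "von_neumann_algebra A"
    and "hilbert_module A act ip"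
    and "orthogonal_system ip I e"
    and "\<And>i. i \<in> I \<Longrightarrow> norm (e i) = 1"
  shows "\<exists>a\<in>A. limitin strong_operator_topology
    (\<lambda>F. 2 *\<^sub>R (\<Sum>i\<in>F. ip x (e i) o\<^sub>L ip (e i) x)
        - (\<Sum>i\<in>F. ip x (e i) o\<^sub>L ip (e i) (e i) o\<^sub>L ip (e i) x))
    a (finite_subsets_at_top I)"
proof -
  interpret hilbert_module A act ip
    by fact
  define t where "t i = 2 *\<^sub>R (ip x (e i) o\<^sub>L ip (e i) x)
      - (ip x (e i) o\<^sub>L ip (e i) (e i) o\<^sub>L ip (e i) x)" for i
  have net_eq: "2 *\<^sub>R (\<Sum>i\<in>F. ip x (e i) o\<^sub>L ip (e i) x)
      - (\<Sum>i\<in>F. ip x (e i) o\<^sub>L ip (e i) (e i) o\<^sub>L ip (e i) x) = (\<Sum>i\<in>F. t i)" for F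
    by (simp add: t_def sum_subtractf scaleR_right.sum)
  have form: "re_inner g (t i h) = 2 * re_inner (ip (e i) x g) (ip (e i) x h)
      - re_inner (ip (e i) x g) (ip (e i) (e i) (ip (e i) x h))" for i g h
    by (simp add: t_def blinfun.diff_left blinfun.scaleR_left re_inner.diff_right
        re_inner.scaleR_right re_inner_ip_swap[of g x])
  have "\<exists>a. limitin strong_operator_topology (\<lambda>F. \<Sum>i\<in>F. t i) a (finite_subsets_at_top I)"
  proof (rule positive_operator_series_strongly_convergent)
    show "re_inner (t i g) h = re_inner g (t i h)" for i g h
      unfolding re_inner_commute[of "t i g"] form
      using re_inner_ip_swap[of "ip (e i) x g" "e i" "e i" "ip (e i) x h"]
      by (simp add: re_inner_commute)
    show "0 \<le> re_inner g (t i g)" if "i \<in> I" for i g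
    proof -
      have "norm (ip (e i) (e i)) = 1"
        using norm_eq[of "e i"] assms(4)[OF that] by simp
      then have "re_inner (ip (e i) x g) (ip (e i) (e i) (ip (e i) x g)) \<le> (norm (ip (e i) x g))\<^sup>2"
        using re_inner_blinfun_le[of "ip (e i) x g" "ip (e i) (e i)"] by simp
      then show ?thesis
        unfolding form re_inner_self using zero_le_power2[of "norm (ip (e i) x g)"] by linarith
    qed
    show "re_inner g ((\<Sum>i\<in>F. t i) g) \<le> (norm (ip x x) + 1) * (norm g)\<^sup>2"
      if "finite F" "F \<subseteq> I" for F g
    proof -
      have orth: "ip (e i) (e j) = 0" if "i \<in> F" "j \<in> F" "i \<noteq> j" for i j
        using assms(3) that \<open>F \<subseteq> I\<close> by (auto simp: orthogonal_system_def)
      have "re_inner g ((\<Sum>i\<in>F. t i) g) \<le> re_inner g (ip x x g)"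
        using module_bessel[where e = e and x = x and g = g, OF orth \<open>finite F\<close>]
        by (simp add: blinfun.sum_left re_inner.sum_right form re_inner_self)
      also have "\<dots> \<le> norm (ip x x) * (norm g)\<^sup>2"
        by (rule re_inner_blinfun_le)
      also have "\<dots> \<le> (norm (ip x x) + 1) * (norm g)\<^sup>2"
        by (intro mult_right_mono) simp_all
      finally show ?thesis .
    qed
    (* The summand 1 covers the case \<open>ip x x = 0\<close>. *)
    show "0 < norm (ip x x) + 1"
      by (simp add: add_nonneg_pos)
  qed
  then obtain a where
    a: "limitin strong_operator_topology (\<lambda>F. \<Sum>i\<in>F. t i) a (finite_subsets_at_top I)"
    by blast
  have closed: "closedin strong_operator_topology A" and one: "id_blinfun \<in> A"
    and add: "\<And>S T. S \<in> A \<Longrightarrow> T \<in> A \<Longrightarrow> S + T \<in> A"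
    and scale: "\<And>c T. T \<in> A \<Longrightarrow> c *\<^sub>C T \<in> A"
    and mult: "\<And>S T. S \<in> A \<Longrightarrow> T \<in> A \<Longrightarrow> S o\<^sub>L T \<in> A"
    using \<open>von_neumann_algebra A\<close> by (auto simp: von_neumann_algebra_def)
  have scaleR: "r *\<^sub>R T \<in> A" if "T \<in> A" for r T
    using scale[OF that, of "complex_of_real r"] by (simp add: scaleC_of_real)
  have diff: "S - T \<in> A" if "S \<in> A" "T \<in> A" for S T
    using add[OF that(1) scaleR[OF that(2), of "-1"]] by simp
  have "t i \<in> A" for i
    unfolding t_def by (intro diff scaleR mult ip_in)
  then have "(\<Sum>i\<in>F. t i) \<in> A" for F
    using scaleR[OF one, of 0] by (induction F rule: infinite_finite_induct) (auto intro: add)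
  then have "a \<in> A"
    by (intro limitin_closedin[OF a closed]) auto
  with a show ?thesis
    unfolding net_eq by blast
qed

end
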